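(* Let $L$ be a complemented modular lattice. Let $n\geq2$ be an integer and let $\langle u_i\mid i<n\rangle$ be a finite sequence of elements of $L$ satisfying the following properties: (i) $\oplus_{i<n}u_i=1$; (ii) $\Delta(u_i)\leq\sum_{j\neq i}\Delta(u_j)$ in $\operatorname{Dim}L$, for all $i<n$. Then there exists at most one normal equivalence on $L$. Furthermore, if such an equivalence $\equiv$ exists, then, for all $a,b\in L$, $a\equiv b$ if and only if there are decompositions $a=\oplus_{i<n^2}a_i$ and $b=\oplus_{i<n^2}b_i$ such that $a_i\sim_2b_i$ for all $i<n^2$.
   Context: For a lattice $L$, the dimension monoid $\operatorname{Dim}L$ is the commutative monoid defined by generators $\Delta(a,b)$ (for $a\leq b$ in $L$) and the relations: (D0) $\Delta(a,a)=0$; (D1) $\Delta(a,c)=\Delta(a,b)+\Delta(b,c)$ for $a\leq b\leq c$; (D2) $\Delta(a,a\vee b)=\Delta(a\wedge b,b)$ for all $a,b\in L$. If $L$ has a least element $0$, write $\Delta(x)=\Delta(0,x)$. Commutative monoids carry the algebraic preordering: $x\leq y$ iff $x+z=y$ for some $z$. In a modular lattice with zero, $x\perp y$ means $x\wedge y=0$, and $z=x\oplus y$ means $x\wedge y=0$ and $x\vee y=z$. This partial operation is commutative and associative, so $\oplus_{i<n}a_i$ makes sense: it is defined iff the sequence $\langle a_i\mid i<n\rangle$ is independent (i.e. $a_k\wedge\bigvee_{i<k}a_i=0$ for all $k<n$), and its value is then $\bigvee_{i<n}a_i$. Elements $a,b$ of a lattice are perspective, $a\sim b$, if there is $x$ with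 $a\wedge x=b\wedge x$ and $a\vee x=b\vee x$. $a\sim_2b$ means there is $c$ with $a\sim c$ and $c\sim b$. A normal equivalence on a modular lattice $L$ with zero is an equivalence relation $\equiv$ on $L$ such that: (E1) $\equiv$ is additive ($x\equiv x'$, $y\equiv y'$ and both $x\oplus y$ and $x'\oplus y'$ defined imply $x\oplus y\equiv x'\oplus y'$) and refining (if $y\equiv x_0\oplus x_1$, then there are $y_0\equiv x_0$ and $y_1\equiv x_1$ with $y=y_0\oplus y_1$); (E2) $x\sim y$ implies $x\equiv y$; (E3) $x\perp y$ and $x\equiv y$ imply $x\sim y$. *)

theory Defs
  imports Main "HOL-Library.Multiset"
begin

section \<open>Complemented modular lattices\<close>

class modular_lattice = lattice +
  assumes modular_law: "x \<le> z \<Longrightarrow> sup x (inf y z) = inf (sup x y) z"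

class complemented_modular_lattice = modular_lattice + bounded_lattice +
  assumes ex_complement: "\<exists>y. inf x y = bot \<and> sup x y = top"

section \<open>The dimension monoid\<close>

text \<open>
  \<open>Dim L\<close> is the free commutative monoid (finite multisets) on the pairs \<open>(a, b)\<close> with
  \<open>a \<le> b\<close>, modulo the monoid congruence generated by (D0), (D1), (D2).  The lattice \<open>L\<close>
  is the whole type \<open>'a\<close>.
\<close>

typedef (overloaded) ('a::order) le_pair = "{(a::'a, b). a \<le> b}"
  by auto

abbreviation gen :: "'a::order \<Rightarrow> 'a \<Rightarrow> 'a le_pair multiset" where
  "gen a b \<equiv> {#Abs_le_pair (a, b)#}"

inductive dim_cong :: "'a::lattice le_pair multiset \<Rightarrow> 'a le_pair multiset \<Rightarrow> bool" where
  dim_refl: "dim_cong M M"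
| dim_sym: "dim_cong M N \<Longrightarrow> dim_cong N M"
| dim_trans: "dim_cong M N \<Longrightarrow> dim_cong N P \<Longrightarrow> dim_cong M P"
| dim_plus: "dim_cong M N \<Longrightarrow> dim_cong M' N' \<Longrightarrow> dim_cong (M + M') (N + N')"
| dim_D0: "dim_cong (gen a a) {#}"
| dim_D1: "a \<le> b \<Longrightarrow> b \<le> c \<Longrightarrow> dim_cong (gen a c) (gen a b + gen b c)"
| dim_D2: "dim_cong (gen a (sup a b)) (gen (inf a b) b)"

quotient_type (overloaded) 'a Dim = "'a::lattice le_pair multiset" / dim_cong
  by (intro equivpI reflpI sympI transpI) (fact dim_refl dim_sym dim_trans)+

instantiation Dim :: (lattice) comm_monoid_add
begin

lift_definition zero_Dim :: "'a Dim" is "{#}" .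

lift_definition plus_Dim :: "'a Dim \<Rightarrow> 'a Dim \<Rightarrow> 'a Dim" is "(+)"
  by (fact dim_plus)

instance
  by standard (transfer, simp add: ac_simps dim_refl)+

end

text \<open>\<open>Delta a b\<close> is meaningful only for \<open>a \<le> b\<close>.\<close>

lift_definition Delta :: "'a::lattice \<Rightarrow> 'a \<Rightarrow> 'a Dim" is gen .

lemma Delta_D0: "Delta a a = 0"
  by transfer (rule dim_D0)

lemma Delta_D1: "a \<le> b \<Longrightarrow> b \<le> c \<Longrightarrow> Delta a c = Delta a b + Delta b c"
  by transfer (rule dim_D1)

lemma Delta_D2: "Delta a (sup a b) = Delta (inf a b) b"
  by transfer (rule dim_D2)

abbreviation Delta0 :: "'a::{lattice, order_bot} \<Rightarrow> 'a Dim" where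
  "Delta0 x \<equiv> Delta bot x"

definition alg_le :: "'m::comm_monoid_add \<Rightarrow> 'm \<Rightarrow> bool" where
  "alg_le x y \<longleftrightarrow> (\<exists>z. x + z = y)"

section \<open>Direct sums, perspectivity, normal equivalences\<close>

definition perp :: "'a::{lattice, order_bot} \<Rightarrow> 'a \<Rightarrow> bool" where
  "perp x y \<longleftrightarrow> inf x y = bot"

text \<open>\<open>is_oplus z x y\<close> says that \<open>x \<oplus> y\<close> is defined and equal to \<open>z\<close>.\<close>

definition is_oplus :: "'a::{lattice, order_bot} \<Rightarrow> 'a \<Rightarrow> 'a \<Rightarrow> bool" where
  "is_oplus z x y \<longleftrightarrow> perp x y \<and> sup x y = z"

text \<open>
  The join of \<open>a 0, \<dots>, a (n - 1)\<close>.  Adjoining \<open>bot\<close> makes the empty join \<open>bot\<close>, because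
  \<^const>\<open>Sup_fin\<close> is specified only on nonempty sets.
\<close>

definition join_lt :: "(nat \<Rightarrow> 'a::{lattice, order_bot}) \<Rightarrow> nat \<Rightarrow> 'a" where
  "join_lt a n = Sup_fin (insert bot (a ` {..<n}))"

definition indep_seq :: "(nat \<Rightarrow> 'a::{lattice, order_bot}) \<Rightarrow> nat \<Rightarrow> bool" where
  "indep_seq a n \<longleftrightarrow> (\<forall>k<n. inf (a k) (join_lt a k) = bot)"

text \<open>\<open>is_oplus_lt z a n\<close> says that the direct sum of \<open>a 0, \<dots>, a (n - 1)\<close> is defined and
  equal to \<open>z\<close>; values of \<open>a\<close> from \<open>n\<close> on are irrelevant.\<close>

definition is_oplus_lt :: "'a::{lattice, order_bot} \<Rightarrow> (nat \<Rightarrow> 'a) \<Rightarrow> nat \<Rightarrow> bool" where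
  "is_oplus_lt z a n \<longleftrightarrow> indep_seq a n \<and> join_lt a n = z"

definition perspective :: "'a::lattice \<Rightarrow> 'a \<Rightarrow> bool" where
  "perspective a b \<longleftrightarrow> (\<exists>x. inf a x = inf b x \<and> sup a x = sup b x)"

definition perspective2 :: "'a::lattice \<Rightarrow> 'a \<Rightarrow> bool" where
  "perspective2 a b \<longleftrightarrow> (\<exists>c. perspective a c \<and> perspective c b)"

definition additive_rel :: "('a::{lattice, order_bot} \<Rightarrow> 'a \<Rightarrow> bool) \<Rightarrow> bool" where
  "additive_rel E \<longleftrightarrow>
    (\<forall>x x' y y' z z'. E x x' \<and> E y y' \<and> is_oplus z x y \<and> is_oplus z' x' y' \<longrightarrow> E z z')"

definition refining_rel :: "('a::{lattice, order_bot} \<Rightarrow> 'a \<Rightarrow> bool) \<Rightarrow> bool" where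
  "refining_rel E \<longleftrightarrow>
    (\<forall>x x0 x1 y. is_oplus x x0 x1 \<and> E y x \<longrightarrow>
      (\<exists>y0 y1. E y0 x0 \<and> E y1 x1 \<and> is_oplus y y0 y1))"

definition normal_equivalence ::
    "('a::{modular_lattice, order_bot} \<Rightarrow> 'a \<Rightarrow> bool) \<Rightarrow> bool" where
  "normal_equivalence E \<longleftrightarrow>
    equivp E \<and>
    additive_rel E \<and> refining_rel E \<and>
    (\<forall>x y. perspective x y \<longrightarrow> E x y) \<and>
    (\<forall>x y. perp x y \<and> E x y \<longrightarrow> perspective x y)"

end

theory Submission
  imports Defs
begin

text \<open>
  Let \<open>\<equiv>\<close> be a normal equivalence, \<open>U\<^sub>i = u\<^sub>0 \<oplus> \<dots> \<oplus> u\<^sub>i\<^sub>-\<^sub>1\<close>, and \<open>v\<^sub>i = \<Oplus>\<^sub>j\<^sub>\<noteq>\<^sub>i u\<^sub>j\<close>.  Everything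
  rests on producing a twofold perspectivity from an equivalence.  Call \<open>x\<close> adapted to \<open>i\<close> if
  \<open>x \<le> U\<^sub>i\<^sub>+\<^sub>1\<close> and \<open>x \<sqinter> U\<^sub>i = \<bottom>\<close>; such an \<open>x\<close> is perspective to a part of \<open>u\<^sub>i\<close>, along the axis \<open>U\<^sub>i\<close>,
  and it is disjoint from \<open>v\<^sub>i\<close>.  Suppose \<open>a \<equiv> b\<close>, with \<open>a\<close> adapted to \<open>i\<close> and \<open>b\<close> adapted to \<open>j\<close>.

  \<^item> If \<open>i < j\<close>, project \<open>b\<close> to \<open>b' \<le> u\<^sub>j\<close>.  Since \<open>a \<le> U\<^sub>j\<close>, the equivalent elements \<open>a\<close> and \<open>b'\<close>
    are disjoint, hence perspective, and \<open>a \<sim> b' \<sim> b\<close>.  The case \<open>i > j\<close> is symmetric.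

  \<^item> If \<open>i = j\<close>, both \<open>a\<close> and \<open>b\<close> are disjoint from \<open>v\<^sub>i\<close>, and it is enough to find \<open>c \<le> v\<^sub>i\<close> with
    \<open>c \<equiv> a\<close>, for then \<open>a \<sim> c \<sim> b\<close>.  As \<open>a\<close> is equivalent to a part of \<open>u\<^sub>i\<close>, such a \<open>c\<close> exists as
    soon as \<open>u\<^sub>i\<close> itself is equivalent to a part of \<open>v\<^sub>i\<close>.

  The hypothesis gives \<open>\<Delta>(u\<^sub>i) \<le> \<Delta>(v\<^sub>i)\<close> in \<open>Dim L\<close>, and \<open>ex_eqv_le_if_alg_le\<close> turns this into the
  required part of \<open>v\<^sub>i\<close>.  Its proof interprets a formal sum \<open>\<Sum>\<Delta>(a\<^sub>k, b\<^sub>k)\<close> as the set of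
  all direct sums \<open>\<Oplus>y\<^sub>k\<close> in which \<open>y\<^sub>k\<close> is equivalent to a complement of \<open>a\<^sub>k\<close> in \<open>b\<^sub>k\<close>.  The three
  defining relations of \<open>Dim L\<close> preserve this set, and \<open>\<Delta>(y)\<close> denotes the class of \<open>y\<close>;
  so \<open>\<Delta>(x) + \<zeta> = \<Delta>(y)\<close> forces \<open>y\<close> to have a direct summand equivalent to \<open>x\<close>.

  For arbitrary \<open>a \<equiv> b\<close>, split \<open>a\<close> into \<open>n\<close> adapted pieces \<open>a\<^sub>i\<close>, transport this to
  \<open>b = \<Oplus>b\<^sub>i\<close> with \<open>b\<^sub>i \<equiv> a\<^sub>i\<close>, split each \<open>b\<^sub>i\<close> into \<open>n\<close> adapted pieces, and transport back.
  The resulting \<open>n\<^sup>2\<close> pairs are equivalent and adapted on both sides.  Conversely, additivity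
  glues twofold perspectivities of the summands to an equivalence.  The resulting description
  of \<open>\<equiv>\<close> mentions only the lattice, whence uniqueness.
\<close>

section \<open>Direct sums in modular lattices\<close>

lemma is_oplus_bot_left [simp]:
  "is_oplus z (bot::'a::{modular_lattice, bounded_lattice_bot}) y \<longleftrightarrow> z = y"
  by (auto simp: is_oplus_def perp_def)

lemma is_oplus_bot_right [simp]:
  "is_oplus z y (bot::'a::{modular_lattice, bounded_lattice_bot}) \<longleftrightarrow> z = y"
  by (auto simp: is_oplus_def perp_def)

lemma is_oplus_commute: "is_oplus z x y \<longleftrightarrow> is_oplus z y x"
  by (simp add: is_oplus_def perp_def ac_simps)

lemma is_oplus_le:
  assumes "is_oplus z x y"
  shows "x \<le> z" "y \<le> z"
  using assms by (auto simp: is_oplus_def)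

lemma inf_eq_bot_mono:
  fixes x :: "'a::{modular_lattice, bounded_lattice_bot}"
  assumes "inf x y = bot" "x' \<le> x" "y' \<le> y"
  shows "inf x' y' = bot"
  using inf_mono[OF assms(2,3)] assms(1) by (simp add: le_bot)

text \<open>Modularity enters through \<open>(y \<squnion> z) \<sqinter> (x \<squnion> y) = y \<squnion> (z \<sqinter> (x \<squnion> y))\<close>: if \<open>x \<squnion> y\<close> is
  disjoint from \<open>z\<close>, whatever \<open>x\<close> shares with \<open>y \<squnion> z\<close> it already shares with \<open>y\<close>.\<close>

lemma is_oplus_assoc:
  fixes x :: "'a::{modular_lattice, bounded_lattice_bot}"
  assumes "is_oplus p x y" "is_oplus w p z"
  shows "is_oplus (sup y z) y z" "is_oplus w x (sup y z)"
proof -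
  have xy: "inf x y = bot" and xyz: "inf (sup x y) z = bot" and w: "w = sup (sup x y) z"
    using assms by (auto simp: is_oplus_def perp_def)
  have "inf y z = bot"
    using xyz by (rule inf_eq_bot_mono) auto
  then show "is_oplus (sup y z) y z"
    by (simp add: is_oplus_def perp_def)
  have "inf x (sup y z) \<le> inf (sup y z) (sup x y)"
    by (simp add: le_infI1)
  also have "\<dots> = sup y (inf z (sup x y))"
    by (rule modular_law[symmetric]) simp
  also have "\<dots> = y"
    using xyz by (simp add: inf.commute)
  finally have "inf x (sup y z) \<le> inf x y"
    by simp
  then have "inf x (sup y z) = bot"
    using xy by (simp add: le_bot)
  then show "is_oplus w x (sup y z)"
    using w by (simp add: is_oplus_def perp_def ac_simps)
qed

lemma is_oplus_assoc':
  fixes x :: "'a::{modular_lattice, bounded_lattice_bot}"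
  assumes "is_oplus q y z" "is_oplus w x q"
  shows "is_oplus (sup x y) x y" "is_oplus w (sup x y) z"
  using is_oplus_assoc[of q z y w x] assms by (auto simp: is_oplus_commute sup.commute)

lemma ex_relative_complement:
  fixes x :: "'a::complemented_modular_lattice"
  assumes "x \<le> y"
  obtains z where "is_oplus y x z"
proof -
  obtain x' where x': "inf x x' = bot" "sup x x' = top"
    using ex_complement by blast
  have "sup x (inf x' y) = y"
    using modular_law[OF assms, of x'] x' by simp
  moreover have "inf x (inf x' y) = bot"
    using x'(1) by (rule inf_eq_bot_mono) auto
  ultimately show thesis
    by (intro that[of "inf x' y"]) (simp add: is_oplus_def perp_def)
qed

lemma perspective_sym: "perspective x y \<Longrightarrow> perspective y x"
  unfolding perspective_def by metis

lemma relative_complements_perspective: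
  assumes "is_oplus y x z" "is_oplus y x z'"
  shows "perspective z z'"
  using assms unfolding is_oplus_def perp_def perspective_def
  by (intro exI[of _ x]) (simp add: ac_simps)

text \<open>Projecting \<open>x\<close> along \<open>c\<close> into \<open>u\<close>; the axis of the perspectivity is \<open>c\<close> itself.\<close>

lemma project_into_summand:
  fixes x :: "'a::{modular_lattice, bounded_lattice_bot}"
  assumes "x \<le> sup c u" "inf x c = bot" "inf u c = bot"
  obtains x' where "x' \<le> u" "perspective x x'"
proof -
  define x' where "x' = inf u (sup x c)"
  have "sup c x' = inf (sup c u) (sup x c)"
    unfolding x'_def by (rule modular_law) simp
  also have "\<dots> = sup x c"
    using assms(1) by (simp add: inf.absorb2)
  finally have "sup x c = sup x' c"
    by (simp add: sup.commute)
  moreover have "inf x' c = bot"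
    using assms(3) by (rule inf_eq_bot_mono) (auto simp: x'_def)
  ultimately have "perspective x x'"
    using assms(2) unfolding perspective_def by (intro exI[of _ c]) simp
  then show thesis
    using that[of x'] by (simp add: x'_def)
qed

section \<open>Finite direct sums\<close>

lemma join_lt_0 [simp]: "join_lt a 0 = bot"
  by (simp add: join_lt_def)

lemma join_lt_Suc:
  fixes a :: "nat \<Rightarrow> 'a::{lattice, order_bot}"
  shows "join_lt a (Suc n) = sup (join_lt a n) (a n)"
proof -
  have "insert bot (a ` {..<Suc n}) = insert (a n) (insert bot (a ` {..<n}))"
    by (auto simp: lessThan_Suc)
  then show ?thesis
    unfolding join_lt_def by (simp only:) (subst Sup_fin.insert, auto simp: sup.commute)
qed

lemma join_lt_upper:
  fixes a :: "nat \<Rightarrow> 'a::{lattice, order_bot}"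
  assumes "i < n"
  shows "a i \<le> join_lt a n"
  unfolding join_lt_def using assms by (intro Sup_fin.coboundedI) auto

lemma join_lt_mono:
  fixes a :: "nat \<Rightarrow> 'a::{lattice, order_bot}"
  assumes "m \<le> n"
  shows "join_lt a m \<le> join_lt a n"
  unfolding join_lt_def using assms by (intro Sup_fin.subset_imp) auto

lemma is_oplus_lt_0 [simp]: "is_oplus_lt z a 0 \<longleftrightarrow> z = bot"
  by (auto simp: is_oplus_lt_def indep_seq_def)

lemma is_oplus_lt_Suc:
  "is_oplus_lt z a (Suc n) \<longleftrightarrow> (\<exists>x. is_oplus_lt x a n \<and> is_oplus z x (a n))"
  by (auto simp: is_oplus_lt_def indep_seq_def is_oplus_def perp_def join_lt_Suc less_Suc_eq
      inf.commute)

lemma is_oplus_lt_cong: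
  assumes "\<And>i. i < n \<Longrightarrow> a i = b i"
  shows "is_oplus_lt z a n \<longleftrightarrow> is_oplus_lt z b n"
  using assms
  by (induction n arbitrary: z) (auto simp: is_oplus_lt_Suc)

lemma is_oplus_lt_le:
  "is_oplus_lt z a n \<Longrightarrow> i < n \<Longrightarrow> a i \<le> z"
  using join_lt_upper by (auto simp: is_oplus_lt_def)

lemma is_oplus_lt_append:
  fixes a :: "nat \<Rightarrow> 'a::{modular_lattice, bounded_lattice_bot}"
  assumes "is_oplus_lt x a p" "is_oplus_lt y (\<lambda>i. a (p + i)) q" "is_oplus z x y"
  shows "is_oplus_lt z a (p + q)"
  using assms(2,3)
proof (induction q arbitrary: y z)
  case 0
  then show ?case
    using assms(1) by simp
next
  case (Suc q)
  then obtain y' where y': "is_oplus_lt y' (\<lambda>i. a (p + i)) q" "is_oplus y y' (a (p + q))"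
    by (auto simp: is_oplus_lt_Suc)
  have "is_oplus_lt (sup x y') a (p + q)"
    using Suc.IH[OF y'(1)] is_oplus_assoc'(1)[OF y'(2) Suc.prems(2)] .
  moreover have "is_oplus z (sup x y') (a (p + q))"
    using is_oplus_assoc'(2)[OF y'(2) Suc.prems(2)] .
  ultimately show ?case
    by (auto simp: is_oplus_lt_Suc)
qed

lemma is_oplus_lt_flatten:
  fixes a :: "nat \<Rightarrow> 'a::{modular_lattice, bounded_lattice_bot}"
  assumes "is_oplus_lt z a n" "\<And>i. i < n \<Longrightarrow> is_oplus_lt (a i) (c i) m"
  shows "is_oplus_lt z (\<lambda>k. c (k div m) (k mod m)) (n * m)"
  using assms
proof (induction n arbitrary: z)
  case 0
  then show ?case by simp
next
  case (Suc n)
  then obtain x where x: "is_oplus_lt x a n" "is_oplus z x (a n)"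
    by (auto simp: is_oplus_lt_Suc)
  have "is_oplus_lt x (\<lambda>k. c (k div m) (k mod m)) (n * m)"
    using Suc x by simp
  moreover have "is_oplus_lt (a n) (\<lambda>i. c ((n * m + i) div m) ((n * m + i) mod m)) m"
    using Suc.prems(2)[of n] by (subst is_oplus_lt_cong[of _ _ "c n"]) auto
  ultimately have "is_oplus_lt z (\<lambda>k. c (k div m) (k mod m)) (n * m + m)"
    using x(2) by (rule is_oplus_lt_append)
  then show ?case
    by (simp add: add.commute)
qed

text \<open>The sections \<open>x \<sqinter> (u\<^sub>0 \<squnion> \<dots> \<squnion> u\<^sub>k\<^sub>-\<^sub>1)\<close> increase from \<open>\<bottom>\<close> to \<open>x\<close>; the pieces are the differences
  of consecutive sections.\<close>

lemma ex_adapted_decomposition: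
  fixes u :: "nat \<Rightarrow> 'a::complemented_modular_lattice"
  assumes "x \<le> join_lt u n"
  obtains a where "is_oplus_lt x a n"
    "\<And>i. i < n \<Longrightarrow> a i \<le> join_lt u (Suc i)" "\<And>i. i < n \<Longrightarrow> inf (a i) (join_lt u i) = bot"
proof -
  have "\<exists>c. is_oplus (inf x (join_lt u (Suc k))) (inf x (join_lt u k)) c" for k
    using ex_relative_complement[of "inf x (join_lt u k)" "inf x (join_lt u (Suc k))"]
    by (metis inf_mono join_lt_mono le_SucI order_refl)
  then obtain a where a: "is_oplus (inf x (join_lt u (Suc k))) (inf x (join_lt u k)) (a k)" for k
    by metis
  have "is_oplus_lt (inf x (join_lt u k)) a k" for k
    by (induction k) (use a in \<open>auto simp: is_oplus_lt_Suc\<close>)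
  then have "is_oplus_lt x a n"
    using assms by (metis inf.absorb1)
  moreover have "a i \<le> inf x (join_lt u (Suc i))" for i
    using is_oplus_le(2)[OF a] .
  moreover have "inf (a i) (join_lt u i) = bot" for i
  proof -
    have "a i \<le> x"
      using is_oplus_le(2)[OF a[of i]] by simp
    then have "inf (a i) (join_lt u i) = inf (inf x (join_lt u i)) (a i)"
      by (metis inf.absorb2 inf.assoc inf.commute)
    then show ?thesis
      using a[of i] by (simp add: is_oplus_def perp_def)
  qed
  ultimately show thesis
    using that by simp
qed

section \<open>Joins of subfamilies of an independent family\<close>

definition join_on :: "('b \<Rightarrow> 'a::{lattice, order_bot}) \<Rightarrow> 'b set \<Rightarrow> 'a" where
  "join_on u S = Sup_fin (insert bot (u ` S))"

lemma join_lt_eq_join_on: "join_lt u n = join_on u {..<n}"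
  by (simp add: join_lt_def join_on_def)

lemma join_on_empty [simp]: "join_on u {} = bot"
  by (simp add: join_on_def)

lemma join_on_insert:
  assumes "finite S"
  shows "join_on u (insert k S) = sup (u k) (join_on u S)"
proof -
  have "insert bot (u ` insert k S) = insert (u k) (insert bot (u ` S))"
    by auto
  then show ?thesis
    unfolding join_on_def using assms by (simp only:) (subst Sup_fin.insert, auto)
qed

lemma join_on_mono:
  assumes "finite T" "S \<subseteq> T"
  shows "join_on u S \<le> join_on u T"
  unfolding join_on_def using assms by (intro Sup_fin.subset_imp) auto

lemma join_on_Un:
  fixes u :: "'b \<Rightarrow> 'a::{lattice, bounded_lattice_bot}"
  assumes "finite S" "finite T"
  shows "join_on u (S \<union> T) = sup (join_on u S) (join_on u T)"
  using assms by (induction S rule: finite_induct) (auto simp: join_on_insert ac_simps)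

text \<open>The largest index \<open>k\<close> can be dropped from the set that contains it: with \<open>U\<close> the join of all
  smaller members, modularity gives \<open>(s \<squnion> u\<^sub>k) \<sqinter> t = (s \<squnion> (u\<^sub>k \<sqinter> U)) \<sqinter> t = s \<sqinter> t\<close> for \<open>s, t \<le> U\<close>.\<close>

lemma indep_seq_disjoint:
  fixes u :: "nat \<Rightarrow> 'a::{modular_lattice, bounded_lattice_bot}"
  assumes "indep_seq u n" "S \<subseteq> {..<n}" "T \<subseteq> {..<n}" "S \<inter> T = {}"
  shows "inf (join_on u S) (join_on u T) = bot"
  using assms
proof (induction n arbitrary: S T)
  case 0
  then show ?case by simp
next
  case (Suc n)
  have indep: "indep_seq u n" and un: "inf (u n) (join_on u {..<n}) = bot"
    using Suc.prems(1) by (auto simp: indep_seq_def join_lt_eq_join_on)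
  have step: "inf (join_on u S) (join_on u T) = bot"
    if S: "S \<subseteq> {..<Suc n}" and T: "T \<subseteq> {..<n}" and ST: "S \<inter> T = {}" for S T
  proof -
    let ?U = "join_on u {..<n}" and ?S = "S - {n}"
    have S': "?S \<subseteq> {..<n}"
      using S by (auto simp: less_Suc_eq)
    have fin: "finite ?S"
      using S' finite_subset by blast
    have IH: "inf (join_on u ?S) (join_on u T) = bot"
      using Suc.IH[OF indep S' T] ST by auto
    have "join_on u S \<le> sup (join_on u ?S) (u n)"
      using join_on_mono[of "insert n ?S" S u] join_on_insert[OF fin, of u n] fin
      by (simp add: subset_insert_iff sup.commute)
    moreover have "join_on u T \<le> ?U"
      using T by (intro join_on_mono) auto
    ultimately have "inf (join_on u S) (join_on u T)
        \<le> inf (inf (sup (join_on u ?S) (u n)) ?U) (join_on u T)"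
      by (meson inf.boundedI inf.cobounded1 inf.cobounded2 order_trans)
    also have "inf (sup (join_on u ?S) (u n)) ?U = sup (join_on u ?S) (inf (u n) ?U)"
      by (rule modular_law[symmetric]) (use S' in \<open>intro join_on_mono; auto\<close>)
    finally show ?thesis
      using un IH by (simp add: le_bot)
  qed
  show ?case
  proof (cases "n \<in> T")
    case True
    then have "S \<subseteq> {..<n}"
      using Suc.prems(2,4) by (fastforce simp: less_Suc_eq)
    then show ?thesis
      using step[of T S] Suc.prems by (simp add: inf.commute Int_commute)
  next
    case False
    then have "T \<subseteq> {..<n}"
      using Suc.prems(3) by (fastforce simp: less_Suc_eq)
    then show ?thesis
      using step[of S T] Suc.prems by simp
  qed
qed

lemma Delta0_oplus:
  fixes x :: "'a::{modular_lattice, bounded_lattice_bot}"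
  assumes "inf x y = bot"
  shows "Delta0 (sup x y) = Delta0 x + Delta0 y"
  using Delta_D1[of bot x "sup x y"] Delta_D2[of x y] assms by simp

lemma Delta0_join_on:
  fixes u :: "nat \<Rightarrow> 'a::{modular_lattice, bounded_lattice_bot}"
  assumes "indep_seq u n" "S \<subseteq> {..<n}"
  shows "Delta0 (join_on u S) = (\<Sum>j\<in>S. Delta0 (u j))"
proof -
  have "finite S"
    using assms(2) finite_subset by blast
  then show ?thesis
    using assms(2)
  proof (induction S rule: finite_induct)
    case empty
    then show ?case by (simp add: Delta_D0)
  next
    case (insert k S)
    have "inf (join_on u {k}) (join_on u S) = bot"
      using insert by (intro indep_seq_disjoint[OF assms(1)]) auto
    then show ?case
      using insert by (simp add: join_on_insert Delta0_oplus)
  qed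
qed

section \<open>Sums of subsets of a lattice\<close>

definition oplus_set :: "'a::{lattice, order_bot} set \<Rightarrow> 'a set \<Rightarrow> 'a set" where
  "oplus_set P Q = {z. \<exists>x\<in>P. \<exists>y\<in>Q. is_oplus z x y}"

lemma oplus_set_commute: "oplus_set P Q = oplus_set Q P"
  unfolding oplus_set_def by (blast intro: is_oplus_commute[THEN iffD1])

lemma oplus_set_assoc_subset:
  fixes P :: "'a::{modular_lattice, bounded_lattice_bot} set"
  shows "oplus_set (oplus_set P Q) R \<subseteq> oplus_set P (oplus_set Q R)"
proof
  fix w assume "w \<in> oplus_set (oplus_set P Q) R"
  then obtain x y z p where "x \<in> P" "y \<in> Q" "z \<in> R" "is_oplus p x y" "is_oplus w p z"
    by (auto simp: oplus_set_def)
  with is_oplus_assoc[of p x y w z] show "w \<in> oplus_set P (oplus_set Q R)"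
    by (auto simp: oplus_set_def)
qed

text \<open>Although \<open>\<oplus>\<close> is partial on elements, it induces a total operation on subsets.  This makes sums
  over finite multisets of sets available, and finite multisets are the words that represent
  elements of the dimension monoid.\<close>

interpretation oplus_set: comm_monoid_mset oplus_set
  "{bot} :: 'a::{modular_lattice, bounded_lattice_bot} set"
proof
  fix P Q R :: "'a set"
  show "oplus_set (oplus_set P Q) R = oplus_set P (oplus_set Q R)"
    using oplus_set_assoc_subset[of P Q R] oplus_set_assoc_subset[of R Q P]
    by (simp add: oplus_set_commute subset_antisym)
  show "oplus_set P Q = oplus_set Q P"
    by (rule oplus_set_commute)
  show "oplus_set P {bot} = P"
    by (auto simp: oplus_set_def)
qed

section \<open>Normal equivalences\<close>

locale normal_eqv =
  fixes E :: "'a::complemented_modular_lattice \<Rightarrow> 'a \<Rightarrow> bool"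
  assumes normal: "normal_equivalence E"
begin

lemma eqv_refl: "E x x"
  and eqv_sym: "E x y \<Longrightarrow> E y x"
  and eqv_trans: "E x y \<Longrightarrow> E y z \<Longrightarrow> E x z"
  using normal unfolding normal_equivalence_def
  by (blast intro: equivp_reflp equivp_symp equivp_transp)+

lemma additive:
  "E x x' \<Longrightarrow> E y y' \<Longrightarrow> is_oplus z x y \<Longrightarrow> is_oplus z' x' y' \<Longrightarrow> E z z'"
  using normal unfolding normal_equivalence_def additive_rel_def by blast

lemma refine:
  assumes "is_oplus x x0 x1" "E y x"
  obtains y0 y1 where "E y0 x0" "E y1 x1" "is_oplus y y0 y1"
  using normal assms unfolding normal_equivalence_def refining_rel_def by blast

lemma perspective_imp: "perspective x y \<Longrightarrow> E x y"
  using normal unfolding normal_equivalence_def by blast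

lemma perp_imp_perspective: "inf x y = bot \<Longrightarrow> E x y \<Longrightarrow> perspective x y"
  using normal unfolding normal_equivalence_def perp_def by blast

lemma perspective2_imp: "perspective2 x y \<Longrightarrow> E x y"
  unfolding perspective2_def by (blast intro: perspective_imp eqv_trans)

text \<open>As \<open>y \<sqinter> \<bottom> = \<bottom>\<close>, an equivalence between \<open>y\<close> and \<open>\<bottom>\<close> is a perspectivity.\<close>

lemma eqv_bot_iff: "E y bot \<longleftrightarrow> y = bot"
proof
  assume "E y bot"
  then have "perspective y bot"
    by (intro perp_imp_perspective) simp_all
  then show "y = bot"
    by (metis inf.absorb1 inf_bot_left perspective_def sup_bot_left sup_ge1)
qed (simp add: eqv_refl)

lemma refine_le:
  assumes "y0 \<le> y" "E x y"
  obtains x0 where "x0 \<le> x" "E x0 y0"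
proof -
  obtain y1 where "is_oplus y y0 y1"
    using ex_relative_complement[OF assms(1)] .
  then show thesis
    using assms(2) by (metis refine that is_oplus_le(1))
qed

lemma refine_lt:
  assumes "is_oplus_lt x a n" "E y x"
  obtains b where "is_oplus_lt y b n" "\<And>i. i < n \<Longrightarrow> E (b i) (a i)"
proof -
  have "\<exists>b. is_oplus_lt y b n \<and> (\<forall>i<n. E (b i) (a i))"
    using assms
  proof (induction n arbitrary: x y)
    case 0
    then show ?case by (simp add: eqv_bot_iff)
  next
    case (Suc n)
    then obtain x' where x': "is_oplus_lt x' a n" "is_oplus x x' (a n)"
      by (auto simp: is_oplus_lt_Suc)
    obtain y0 y1 where y: "E y0 x'" "E y1 (a n)" "is_oplus y y0 y1"
      using refine[OF x'(2) Suc.prems(2)] .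
    obtain b where b: "is_oplus_lt y0 b n" "\<forall>i<n. E (b i) (a i)"
      using Suc.IH[OF x'(1) y(1)] by blast
    have "is_oplus_lt y0 (b(n := y1)) n"
      using b(1) by (subst is_oplus_lt_cong[of _ _ b]) auto
    then have "is_oplus_lt y (b(n := y1)) (Suc n)"
      using y(3) by (auto simp: is_oplus_lt_Suc)
    moreover have "\<forall>i<Suc n. E ((b(n := y1)) i) (a i)"
      using b(2) y(2) by (simp add: less_Suc_eq)
    ultimately show ?case
      by blast
  qed
  then show thesis
    using that by blast
qed

lemma additive_lt:
  assumes "is_oplus_lt x a n" "is_oplus_lt y b n" "\<And>i. i < n \<Longrightarrow> E (a i) (b i)"
  shows "E x y"
  using assms
proof (induction n arbitrary: x y)
  case 0
  then show ?case by (simp add: eqv_refl)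
next
  case (Suc n)
  then obtain x' y' where "is_oplus_lt x' a n" "is_oplus x x' (a n)"
    "is_oplus_lt y' b n" "is_oplus y y' (b n)"
    by (auto simp: is_oplus_lt_Suc)
  then show ?case
    using Suc.IH[of x' y'] Suc.prems(3) by (meson additive less_Suc_eq)
qed

section \<open>Comparison in the dimension monoid\<close>

definition differences :: "'a le_pair \<Rightarrow> 'a set" where
  "differences p = (case Rep_le_pair p of (a, b) \<Rightarrow> {y. \<exists>c. is_oplus b a c \<and> E y c})"

text \<open>The elements that a formal sum of generators of \<open>Dim L\<close> measures.  Taking values in sets
  of lattice elements, rather than in a monoid of equivalence classes, also gives a value to sums
  too large to be realized in the lattice: the empty set.\<close>

definition realizations :: "'a le_pair multiset \<Rightarrow> 'a set" where
  "realizations M = oplus_set.F (image_mset differences M)"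

lemma realizations_empty [simp]: "realizations {#} = {bot}"
  by (simp add: realizations_def)

lemma realizations_plus:
  "realizations (M + N) = oplus_set (realizations M) (realizations N)"
  by (simp add: realizations_def)

lemma realizations_gen:
  assumes "a \<le> b"
  shows "realizations (gen a b) = {y. \<exists>c. is_oplus b a c \<and> E y c}"
  using assms by (simp add: realizations_def differences_def Abs_le_pair_inverse)

lemma realizations_gen_bot: "realizations (gen bot x) = {y. E y x}"
  by (simp add: realizations_gen)

lemma realizations_D0: "realizations (gen a a) = {bot}"
proof -
  have "is_oplus a a c \<longleftrightarrow> c = bot" for c
    by (auto simp: is_oplus_def perp_def inf.absorb2 dest: is_oplus_le(2) sup.absorb_iff1[THEN iffD2])
  then show ?thesis
    by (simp add: realizations_gen eqv_bot_iff)
qed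

text \<open>If \<open>c\<^sub>0\<close> and \<open>c\<^sub>1\<close> are differences for \<open>a \<le> b\<close> and \<open>b \<le> c\<close>, then \<open>c\<^sub>0 \<oplus> c\<^sub>1\<close> is one for \<open>a \<le> c\<close>.
  All differences for \<open>a \<le> c\<close> are perspective, so refinement splits any realization of the left
  side along \<open>c\<^sub>0 \<oplus> c\<^sub>1\<close>, and additivity gives the converse.\<close>

lemma realizations_D1:
  assumes "a \<le> b" "b \<le> c"
  shows "realizations (gen a c) = realizations (gen a b + gen b c)"
proof (intro set_eqI iffI)
  fix y assume "y \<in> realizations (gen a c)"
  then obtain d where d: "is_oplus c a d" "E y d"
    using assms by (auto simp: realizations_gen)
  obtain c0 c1 where c: "is_oplus b a c0" "is_oplus c b c1"
    using ex_relative_complement[OF assms(1)] ex_relative_complement[OF assms(2)] by metis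
  have "E y (sup c0 c1)"
    using relative_complements_perspective[OF d(1) is_oplus_assoc(2)[OF c]] d(2)
    by (blast intro: eqv_trans perspective_imp)
  then obtain y0 y1 where "E y0 c0" "E y1 c1" "is_oplus y y0 y1"
    using refine[OF is_oplus_assoc(1)[OF c]] by blast
  then show "y \<in> realizations (gen a b + gen b c)"
    unfolding realizations_plus using c assms by (auto simp: realizations_gen oplus_set_def)
next
  fix y assume "y \<in> realizations (gen a b + gen b c)"
  then obtain y0 y1 c0 c1 where y: "is_oplus y y0 y1" "E y0 c0" "E y1 c1"
    and c: "is_oplus b a c0" "is_oplus c b c1"
    unfolding realizations_plus using assms by (auto simp: realizations_gen oplus_set_def)
  have "E y (sup c0 c1)"
    using additive[OF y(2,3,1) is_oplus_assoc(1)[OF c]] .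
  then show "y \<in> realizations (gen a c)"
    using is_oplus_assoc(2)[OF c] assms by (auto simp: realizations_gen)
qed

text \<open>A complement of \<open>a \<sqinter> b\<close> in \<open>b\<close> is also a complement of \<open>a\<close> in \<open>a \<squnion> b\<close>.\<close>

lemma realizations_D2: "realizations (gen a (sup a b)) = realizations (gen (inf a b) b)"
proof -
  have transfer: "is_oplus (sup a b) a c" if "is_oplus b (inf a b) c" for c
  proof -
    have "c \<le> b" and c: "inf (inf a b) c = bot" "sup (inf a b) c = b"
      using that is_oplus_le(2)[OF that] by (auto simp: is_oplus_def perp_def)
    then have "inf a c = bot"
      by (metis inf.absorb2 inf.assoc)
    moreover have "sup a c = sup a b"
      by (metis c(2) sup.assoc sup_inf_absorb)
    ultimately show ?thesis
      by (simp add: is_oplus_def perp_def)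
  qed
  obtain c where c: "is_oplus b (inf a b) c"
    using ex_relative_complement[of "inf a b" b] by auto
  have "E y c" if "is_oplus (sup a b) a d" "E y d" for y d
    using relative_complements_perspective[OF that(1) transfer[OF c]] that(2)
    by (blast intro: eqv_trans perspective_imp)
  then show ?thesis
    using transfer c by (auto simp: realizations_gen)
qed

lemma realizations_dim_cong:
  "dim_cong M N \<Longrightarrow> realizations M = realizations N"
proof (induction rule: dim_cong.induct)
  case (dim_D1 a b c)
  then show ?case by (rule realizations_D1)
qed (simp_all only: realizations_D0 realizations_D2 realizations_plus realizations_empty)

text \<open>An inequality in the dimension monoid is witnessed in the lattice: \<open>y\<close> realizes \<open>\<Delta>(y)\<close>, hence
  also \<open>\<Delta>(x) + \<zeta>\<close>, and the summand of \<open>y\<close> that realizes \<open>\<Delta>(x)\<close> is equivalent to \<open>x\<close>.\<close>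

lemma ex_eqv_le_if_alg_le:
  assumes "alg_le (Delta0 x) (Delta0 y)"
  obtains x' where "x' \<le> y" "E x' x"
proof -
  obtain z where z: "Delta0 x + z = Delta0 y"
    using assms by (auto simp: alg_le_def)
  obtain M where "z = abs_Dim M"
    using Quotient_Dim[THEN Quotient_abs_rep] by metis
  with z have "dim_cong (gen bot x + M) (gen bot y)"
    by (simp add: Delta.abs_eq plus_Dim.abs_eq Dim.abs_eq_iff)
  then have "realizations (gen bot x + M) = realizations (gen bot y)"
    by (rule realizations_dim_cong)
  moreover have "y \<in> realizations (gen bot y)"
    by (simp add: realizations_gen_bot eqv_refl)
  ultimately have "y \<in> oplus_set {x'. E x' x} (realizations M)"
    unfolding realizations_plus by (simp only: realizations_gen_bot)
  then show thesis
    using that by (auto simp: oplus_set_def dest: is_oplus_le(1))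
qed

section \<open>Normal equivalence and twofold perspectivity\<close>

lemma perspective2_if_common_perp:
  assumes "E a b" "E c a" "inf a c = bot" "inf b c = bot"
  shows "perspective2 a b"
proof -
  have "E a c" "E c b"
    using assms(1,2) eqv_sym eqv_trans by blast+
  then have "perspective a c" "perspective c b"
    using assms(3,4) by (simp_all add: perp_imp_perspective inf.commute)
  then show ?thesis
    unfolding perspective2_def by blast
qed

lemma perspective2_if_projects_to_perp:
  assumes "E a b" "perspective b b'" "inf a b' = bot"
  shows "perspective2 a b"
proof -
  have "E a b'"
    using assms(1) perspective_imp[OF assms(2)] by (rule eqv_trans)
  then have "perspective a b'"
    using assms(3) by (simp add: perp_imp_perspective)
  then show ?thesis
    unfolding perspective2_def using perspective_sym[OF assms(2)] by blast
qed

end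

lemma perspective2_sym: "perspective2 a b \<Longrightarrow> perspective2 b a"
  unfolding perspective2_def using perspective_sym by metis

locale bounded_frame = normal_eqv E
  for E :: "'a::complemented_modular_lattice \<Rightarrow> 'a \<Rightarrow> bool" +
  fixes u :: "nat \<Rightarrow> 'a" and n :: nat
  assumes indep: "indep_seq u n" and spans: "join_lt u n = top"
    and bounded: "i < n \<Longrightarrow> alg_le (Delta0 (u i)) (\<Sum>j\<in>{..<n} - {i}. Delta0 (u j))"
begin

text \<open>The elements adapted to \<open>i\<close> are those that can occur as the \<open>i\<close>-th difference between
  consecutive sections by the joins of the initial segments of \<open>u\<close>.\<close>

definition adapted :: "nat \<Rightarrow> 'a \<Rightarrow> bool" where
  "adapted i x \<longleftrightarrow> x \<le> join_lt u (Suc i) \<and> inf x (join_lt u i) = bot"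

lemma adapted_le: "adapted i x \<Longrightarrow> y \<le> x \<Longrightarrow> adapted i y"
  unfolding adapted_def by (blast intro: order_trans inf_eq_bot_mono[OF _ _ order_refl])

lemma adapted_project:
  assumes "i < n" "adapted i x"
  obtains x' where "x' \<le> u i" "perspective x x'"
proof (rule project_into_summand)
  show "x \<le> sup (join_lt u i) (u i)" "inf x (join_lt u i) = bot"
    using assms(2) by (simp_all add: adapted_def join_lt_Suc)
  show "inf (u i) (join_lt u i) = bot"
    using assms(1) indep by (simp add: indep_seq_def)
qed (rule that)

lemma adapted_decomposition:
  obtains a where "is_oplus_lt x a n" "\<And>i. i < n \<Longrightarrow> adapted i (a i)"
  using ex_adapted_decomposition[of x u n] spans unfolding adapted_def by (metis top_greatest)

text \<open>Modularity and independence give \<open>U\<^sub>i\<^sub>+\<^sub>1 \<sqinter> v\<^sub>i = U\<^sub>i\<close>; so below \<open>U\<^sub>i\<^sub>+\<^sub>1\<close>, disjointness from \<open>v\<^sub>i\<close> is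
  the same as disjointness from \<open>U\<^sub>i\<close>.\<close>

lemma adapted_perp_others:
  assumes "i < n" "adapted i x"
  shows "inf x (join_on u ({..<n} - {i})) = bot"
proof -
  let ?U = "join_on u {..<i}" and ?V = "join_on u {..<Suc i}" and ?W = "join_on u {Suc i..<n}"
  have x: "x \<le> ?V" "inf x ?U = bot"
    using assms(2) by (auto simp: adapted_def join_lt_eq_join_on)
  have "{..<n} - {i} = {..<i} \<union> {Suc i..<n}"
    using assms(1) by auto
  then have eq: "join_on u ({..<n} - {i}) = sup ?U ?W"
    by (simp add: join_on_Un)
  have "inf ?W ?V = bot"
    using assms(1) by (intro indep_seq_disjoint[OF indep]) auto
  moreover have "sup ?U (inf ?W ?V) = inf (sup ?U ?W) ?V"
    by (rule modular_law) (intro join_on_mono; auto)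
  ultimately have "inf ?V (sup ?U ?W) = ?U"
    by (simp add: inf.commute)
  moreover have "inf x (sup ?U ?W) = inf x (inf ?V (sup ?U ?W))"
    using x(1) by (simp add: inf.absorb1 flip: inf.assoc)
  ultimately show ?thesis
    using x(2) eq by simp
qed

lemma adapted_less_perp:
  assumes "i < j" "j < n" "adapted i x" "y \<le> u j"
  shows "inf x y = bot"
proof -
  have "inf (join_lt u j) (u j) = bot"
    using indep assms(2) by (simp add: indep_seq_def inf.commute)
  moreover have "x \<le> join_lt u j"
    using assms(1,3) join_lt_mono[of "Suc i" j u] by (auto simp: adapted_def)
  ultimately show ?thesis
    using assms(4) by (rule inf_eq_bot_mono)
qed

lemma adapted_less_perspective2:
  assumes "i < j" "j < n" "adapted i a" "adapted j b" "E a b"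
  shows "perspective2 a b"
proof -
  obtain b' where "b' \<le> u j" "perspective b b'"
    using adapted_project assms(2,4) by blast
  then show ?thesis
    using perspective2_if_projects_to_perp adapted_less_perp assms by blast
qed

text \<open>The bound on \<open>\<Delta>(u\<^sub>i)\<close> supplies a copy \<open>w\<close> of \<open>u\<^sub>i\<close> below the join of the other members; the
  part of \<open>u\<^sub>i\<close> to which \<open>a\<close> projects is copied into \<open>w\<close> by refinement.\<close>

lemma adapted_ex_copy_in_others:
  assumes "i < n" "adapted i a"
  obtains c where "c \<le> join_on u ({..<n} - {i})" "E c a"
proof -
  have "alg_le (Delta0 (u i)) (Delta0 (join_on u ({..<n} - {i})))"
    using bounded[OF assms(1)] Delta0_join_on[OF indep, of "{..<n} - {i}"] by simp
  then obtain w where w: "w \<le> join_on u ({..<n} - {i})" "E w (u i)"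
    by (rule ex_eqv_le_if_alg_le)
  obtain a' where a': "a' \<le> u i" "perspective a a'"
    using adapted_project[OF assms] .
  obtain c where "c \<le> w" "E c a'"
    using refine_le[OF a'(1) w(2)] .
  have "c \<le> join_on u ({..<n} - {i})"
    using \<open>c \<le> w\<close> w(1) by (rule order_trans)
  moreover have "E c a"
    using \<open>E c a'\<close> eqv_sym[OF perspective_imp[OF a'(2)]] by (rule eqv_trans)
  ultimately show thesis
    by (rule that)
qed

text \<open>For \<open>i \<noteq> j\<close> the middle element is the projection of one side into its \<open>u\<close>; for \<open>i = j\<close>, where
  both projections lie in the same \<open>u\<^sub>i\<close>, it is a copy moved into the other members.\<close>

lemma adapted_perspective2:
  assumes "i < n" "j < n" "adapted i a" "adapted j b" "E a b"
  shows "perspective2 a b"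
proof (cases i j rule: linorder_cases)
  case less
  then show ?thesis
    using adapted_less_perspective2 assms by blast
next
  case equal
  obtain c where c: "c \<le> join_on u ({..<n} - {i})" "E c a"
    using adapted_ex_copy_in_others assms(1,3) by blast
  have "inf a c = bot" "inf b c = bot"
    using inf_eq_bot_mono[OF adapted_perp_others order_refl c(1)] assms(1,3,4) equal by auto
  then show ?thesis
    using perspective2_if_common_perp assms(5) c(2) by blast
next
  case greater
  then show ?thesis
    using adapted_less_perspective2 assms eqv_sym perspective2_sym by blast
qed

theorem eqv_iff:
  "E a b \<longleftrightarrow>
    (\<exists>a' b'. is_oplus_lt a a' (n ^ 2) \<and> is_oplus_lt b b' (n ^ 2) \<and>
      (\<forall>i < n ^ 2. perspective2 (a' i) (b' i)))"
proof
  assume ab: "E a b"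
  obtain a1 where a1: "is_oplus_lt a a1 n" "\<And>i. i < n \<Longrightarrow> adapted i (a1 i)"
    using adapted_decomposition[of a] by blast
  obtain b1 where b1: "is_oplus_lt b b1 n" "\<And>i. i < n \<Longrightarrow> E (b1 i) (a1 i)"
    using refine_lt[OF a1(1) eqv_sym[OF ab]] by blast
  have "\<exists>c d. is_oplus_lt (b1 i) d n \<and> (\<forall>j<n. adapted j (d j)) \<and>
      is_oplus_lt (a1 i) c n \<and> (\<forall>j<n. E (c j) (d j))" if i: "i < n" for i
  proof -
    obtain d where d: "is_oplus_lt (b1 i) d n" "\<And>j. j < n \<Longrightarrow> adapted j (d j)"
      using adapted_decomposition[of "b1 i"] by blast
    obtain c where "is_oplus_lt (a1 i) c n" "\<And>j. j < n \<Longrightarrow> E (c j) (d j)"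
      using refine_lt[OF d(1) eqv_sym[OF b1(2)[OF i]]] by blast
    with d show ?thesis by blast
  qed
  then obtain c d where
    d: "\<And>i. i < n \<Longrightarrow> is_oplus_lt (b1 i) (d i) n"
      "\<And>i j. i < n \<Longrightarrow> j < n \<Longrightarrow> adapted j (d i j)" and
    c: "\<And>i. i < n \<Longrightarrow> is_oplus_lt (a1 i) (c i) n" and
    cd: "\<And>i j. i < n \<Longrightarrow> j < n \<Longrightarrow> E (c i j) (d i j)"
    by metis
  \<comment> \<open>\<open>d i j\<close> is adapted to \<open>j\<close> by choice, and \<open>c i j\<close> to \<open>i\<close> because it lies below \<open>a1 i\<close>.\<close>
  have pieces: "perspective2 (c i j) (d i j)" if "i < n" "j < n" for i j
    using adapted_perspective2[OF that _ d(2)[OF that] cd[OF that]]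
      adapted_le[OF a1(2)] is_oplus_lt_le[OF c] that by blast
  have index: "k div n < n" "k mod n < n" if "k < n ^ 2" for k
    using that by (cases "n = 0"; simp add: less_mult_imp_div_less power2_eq_square)+
  have "is_oplus_lt a (\<lambda>k. c (k div n) (k mod n)) (n ^ 2)"
    "is_oplus_lt b (\<lambda>k. d (k div n) (k mod n)) (n ^ 2)"
    unfolding power2_eq_square
    using is_oplus_lt_flatten[OF a1(1) c] is_oplus_lt_flatten[OF b1(1) d(1)] by auto
  then show "\<exists>a' b'. is_oplus_lt a a' (n ^ 2) \<and> is_oplus_lt b b' (n ^ 2) \<and>
      (\<forall>i < n ^ 2. perspective2 (a' i) (b' i))"
    using pieces index by blast
next
  assume "\<exists>a' b'. is_oplus_lt a a' (n ^ 2) \<and> is_oplus_lt b b' (n ^ 2) \<and>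
      (\<forall>i < n ^ 2. perspective2 (a' i) (b' i))"
  then show "E a b"
    using additive_lt perspective2_imp by blast
qed

end

theorem corollary10p19:
  fixes u :: "nat \<Rightarrow> 'a::complemented_modular_lattice" and n :: nat
  assumes "n \<ge> 2"
    and "is_oplus_lt top u n"
    and "\<forall>i<n. alg_le (Delta0 (u i)) (\<Sum>j\<in>{..<n} - {i}. Delta0 (u j))"
  shows "(\<exists>\<^sub>\<le>\<^sub>1 E :: 'a \<Rightarrow> 'a \<Rightarrow> bool. normal_equivalence E) \<and>
    (\<forall>E :: 'a \<Rightarrow> 'a \<Rightarrow> bool. normal_equivalence E \<longrightarrow>
      (\<forall>a b. E a b \<longleftrightarrow>
        (\<exists>a' b'. is_oplus_lt a a' (n ^ 2) \<and> is_oplus_lt b b' (n ^ 2) \<and>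
          (\<forall>i < n ^ 2. perspective2 (a' i) (b' i)))))"
proof -
  have characterization: "E a b \<longleftrightarrow>
      (\<exists>a' b'. is_oplus_lt a a' (n ^ 2) \<and> is_oplus_lt b b' (n ^ 2) \<and>
        (\<forall>i < n ^ 2. perspective2 (a' i) (b' i)))"
    if "normal_equivalence E" for E :: "'a \<Rightarrow> 'a \<Rightarrow> bool" and a b
  proof -
    interpret bounded_frame E u n
      using that assms(2,3) by unfold_locales (auto simp: is_oplus_lt_def)
    show ?thesis
      by (rule eqv_iff)
  qed
  have "\<exists>\<^sub>\<le>\<^sub>1 E :: 'a \<Rightarrow> 'a \<Rightarrow> bool. normal_equivalence E"
  proof (intro Uniq_I ext)
    fix E F :: "'a \<Rightarrow> 'a \<Rightarrow> bool" and a b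
    assume "normal_equivalence E" "normal_equivalence F"
    then show "F a b = E a b"
      using characterization[of E a b] characterization[of F a b] by argo
  qed
  with characterization show ?thesis
    by blast
qed

end
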